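(* Let $w$ be an infinite word over $\{a,b\}$ and suppose that there is an endomorphism $\varphi$ of the semigroup $\{a,b\}^+$ such that $\varphi(w)$ is a suffix of either $\mathbf{t}$ or $\xi(\mathbf{t})$. Then $w$ is itself a suffix of either $\mathbf{t}$ or $\xi(\mathbf{t})$.
   Context: Let $\{a,b\}^+$ be the free semigroup (nonempty finite words) on $\{a,b\}$. Let $\mu$ be the endomorphism of $\{a,b\}^+$ with $\mu(a)=ab$, $\mu(b)=ba$, and let $\xi$ be the endomorphism with $\xi(a)=b$, $\xi(b)=a$. The Prouhet-Thue-Morse sequence $\mathbf{t}$ is the infinite word over $\{a,b\}$ (indexed by the positive integers) whose prefix of length $2^n$ is $\mu^n(a)$ for every $n\ge 0$. Endomorphisms $\varphi$ of $\{a,b\}^+$ act on infinite words $w=a_1a_2\cdots$ by $\varphi(w)=\varphi(a_1)\varphi(a_2)\cdots$. A suffix of an infinite word $a_1a_2\cdots$ is an infinite word of the form $a_ka_{k+1}\cdots$ with $k\ge 1$. *)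

theory Defs
  imports Main "HOL-Library.Stream"
begin

datatype letter = A | B

(* The free semigroup {a,b}^+ is the set of nonempty lists; the value of phi at the empty list
   is unconstrained. *)
definition semigroup_endo :: "(letter list \<Rightarrow> letter list) \<Rightarrow> bool" where
  "semigroup_endo phi \<longleftrightarrow>
     (\<forall>u. u \<noteq> [] \<longrightarrow> phi u \<noteq> []) \<and>
     (\<forall>u v. u \<noteq> [] \<longrightarrow> v \<noteq> [] \<longrightarrow> phi (u @ v) = phi u @ phi v)"

fun mu_letter :: "letter \<Rightarrow> letter list" where
  "mu_letter A = [A, B]"
| "mu_letter B = [B, A]"

fun xi_letter :: "letter \<Rightarrow> letter list" where
  "xi_letter A = [B]"
| "xi_letter B = [A]"

definition mu :: "letter list \<Rightarrow> letter list" where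
  "mu u = concat (map mu_letter u)"

definition xi :: "letter list \<Rightarrow> letter list" where
  "xi u = concat (map xi_letter u)"

lemma semigroup_endo_mu: "semigroup_endo mu"
proof -
  have "mu_letter x \<noteq> []" for x
    by (cases x) auto
  then show ?thesis
    by (auto simp: semigroup_endo_def mu_def neq_Nil_conv)
qed

lemma semigroup_endo_xi: "semigroup_endo xi"
proof -
  have "xi_letter x \<noteq> []" for x
    by (cases x) auto
  then show ?thesis
    by (auto simp: semigroup_endo_def xi_def neq_Nil_conv)
qed

(* phi(a_1 a_2 ...) = phi(a_1) phi(a_2) ...; the corecursive flat is the infinite concatenation
   because every phi(a_i) is nonempty when phi is a semigroup endomorphism. *)
definition act :: "(letter list \<Rightarrow> letter list) \<Rightarrow> letter stream \<Rightarrow> letter stream" where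
  "act phi w = flat (smap (\<lambda>x. phi [x]) w)"

definition is_suffix :: "letter stream \<Rightarrow> letter stream \<Rightarrow> bool" where
  "is_suffix v w \<longleftrightarrow> (\<exists>k. v = sdrop k w)"

definition thue_morse :: "letter stream" where
  "thue_morse = (THE t. \<forall>n. stake (2 ^ n) t = (mu ^^ n) [A])"

lemma mu_append: "mu (u @ v) = mu u @ mu v"
  by (simp add: mu_def)

lemma length_mu: "length (mu u) = 2 * length u"
proof (induction u)
  case (Cons x u)
  then show ?case by (cases x) (simp_all add: mu_def)
qed (simp add: mu_def)

lemma mu_pow_append: "(mu ^^ n) (u @ v) = (mu ^^ n) u @ (mu ^^ n) v"
  by (induction n) (simp_all add: mu_append)

lemma length_mu_pow: "length ((mu ^^ n) u) = 2 ^ n * length u"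
  by (induction n) (simp_all add: length_mu)

lemma mu_pow_A_Suc: "(mu ^^ Suc n) [A] = (mu ^^ n) [A] @ (mu ^^ n) [B]"
proof -
  have "(mu ^^ Suc n) [A] = (mu ^^ n) (mu [A])"
    by (simp add: funpow_swap1)
  also have "mu [A] = [A] @ [B]"
    by (simp add: mu_def)
  finally show ?thesis
    by (simp only: mu_pow_append)
qed

lemma mu_pow_A_nth:
  assumes "i < 2 ^ m" and "m \<le> n"
  shows "(mu ^^ n) [A] ! i = (mu ^^ m) [A] ! i"
  using assms(2)
proof (induction n rule: dec_induct)
  case (step n)
  have "(2::nat) ^ m \<le> 2 ^ n"
    using step by simp
  with assms(1) have "i < 2 ^ n"
    by (rule order.strict_trans2)
  then have "i < length ((mu ^^ n) [A])"
    by (simp add: length_mu_pow)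
  then show ?case
    using step by (simp only: mu_pow_A_Suc nth_append if_True)
qed simp

(* The defining property determines exactly one infinite word. *)
lemma thue_morse_ex1: "\<exists>!t. \<forall>n. stake (2 ^ n) t = (mu ^^ n) [A]"
proof (rule ex_ex1I)
  let ?t = "smap (\<lambda>i. (mu ^^ i) [A] ! i) nats"
  have "stake (2 ^ n) ?t = (mu ^^ n) [A]" for n
  proof (rule nth_equalityI)
    show "length (stake (2 ^ n) ?t) = length ((mu ^^ n) [A])"
      by (simp add: length_mu_pow)
  next
    fix i
    assume "i < length (stake (2 ^ n) ?t)"
    then have i: "i < 2 ^ n" by simp
    have "i < 2 ^ i" by (rule less_exp)
    then have "(mu ^^ i) [A] ! i = (mu ^^ n) [A] ! i"
      using mu_pow_A_nth[of i i n] mu_pow_A_nth[of i n i] i by (cases "i \<le> n") simp_all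
    then show "stake (2 ^ n) ?t ! i = (mu ^^ n) [A] ! i"
      using i by (simp add: stake_nth)
  qed
  then show "\<exists>t. \<forall>n. stake (2 ^ n) t = (mu ^^ n) [A]"
    by blast
next
  fix s t
  assume s: "\<forall>n. stake (2 ^ n) s = (mu ^^ n) [A]"
    and t: "\<forall>n. stake (2 ^ n) t = (mu ^^ n) [A]"
  have "s !! i = t !! i" for i
  proof -
    have i: "i < 2 ^ i" by (rule less_exp)
    have "stake (2 ^ i) s ! i = stake (2 ^ i) t ! i"
      using s t by simp
    then show ?thesis
      using i by (simp add: stake_nth)
  qed
  then show "s = t"
    by (metis (no_types, lifting) ext stream_smap_nats)
qed

lemma stake_thue_morse: "stake (2 ^ n) thue_morse = (mu ^^ n) [A]"
  using theI'[OF thue_morse_ex1] unfolding thue_morse_def by blast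

end

theory Submission imports Defs "HOL-Library.Sublist" begin

text \<open>
  Composing with \<open>\<xi>\<close>, we may assume that \<open>\<phi>(w)\<close> is a suffix of \<open>t\<close>. Since \<open>t\<close> is overlap-free, so is \<open>w\<close>,
  and hence \<open>w\<close> contains \<open>aa\<close>, \<open>bb\<close>, \<open>abab\<close> and \<open>baba\<close> (every sufficiently long overlap-free word
  does). So \<open>t\<close> contains the squares of \<open>\<phi>(a)\<close>, \<open>\<phi>(b)\<close>, \<open>\<phi>(ab)\<close> and \<open>\<phi>(ba)\<close>. The only squares of
  words of odd length in \<open>t\<close> are those of \<open>a\<close>, \<open>b\<close>, \<open>aba\<close> and \<open>bab\<close>, which leaves only the identity
  and \<open>\<xi>\<close> if \<open>|\<phi>(a)|\<close> or \<open>|\<phi>(b)|\<close> is odd. If both are even, then \<open>\<phi>\<close> is, up to conjugation by a letter,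
  of the form \<open>\<mu> \<circ> \<phi>'\<close>, and \<open>\<phi>'(w)\<close> is again a suffix of \<open>t\<close>; induct on \<open>|\<phi>(a)| + |\<phi>(b)|\<close>.
\<close>

section \<open>Factors and morphisms of infinite words\<close>

definition factor :: "'a list \<Rightarrow> 'a stream \<Rightarrow> bool" where
  "factor u s \<longleftrightarrow> (\<exists>i. stake (length u) (sdrop i s) = u)"

lemma factor_iff: "factor u s \<longleftrightarrow> (\<exists>p r. s = p @- u @- r)"
proof
  assume "factor u s"
  then obtain i where "stake (length u) (sdrop i s) = u"
    by (auto simp: factor_def)
  then have "sdrop i s = u @- sdrop (length u) (sdrop i s)"
    by (metis stake_sdrop)
  then have "s = stake i s @- u @- sdrop (length u) (sdrop i s)"
    by (metis stake_sdrop)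
  then show "\<exists>p r. s = p @- u @- r"
    by blast
next
  assume "\<exists>p r. s = p @- u @- r"
  then obtain p r where "s = p @- u @- r"
    by blast
  then have "stake (length u) (sdrop (length p) s) = u"
    by (simp add: sdrop_shift stake_shift)
  then show "factor u s"
    unfolding factor_def by blast
qed

lemma factor_infix: "factor (p @ u @ q) s \<Longrightarrow> factor u s"
  unfolding factor_iff by (metis shift_append)

lemma factor_sdrop: "factor u (sdrop k s) \<Longrightarrow> factor u s"
  unfolding factor_def by auto

text \<open>Replaces coinduction below: identities between infinite concatenations reduce to list
  identities on arbitrarily long common prefixes.\<close>

lemma stream_eq_if_prefixes_eq:
  assumes "\<And>n. \<exists>p r r'. n < length p \<and> s = p @- r \<and> s' = p @- r'"
  shows "s = s'"
proof -
  have "s !! n = s' !! n" for n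
    using assms[of n] by auto
  then show ?thesis
    using smap_alt[of id s s'] by (simp add: stream.map_id)
qed

section \<open>Images of infinite words under morphisms\<close>

lemma flat_smap_shift:
  assumes "\<And>c. f c \<noteq> []"
  shows "flat (smap f (u @- s)) = concat (map f u) @- flat (smap f s)"
  using assms by (induction u) simp_all

lemma flat_smap_split:
  assumes "\<And>c. f c \<noteq> []"
  shows "flat (smap f s) = concat (map f (stake n s)) @- flat (smap f (sdrop n s))"
  using flat_smap_shift[of f "stake n s" "sdrop n s", OF assms] by (simp only: stake_sdrop)

lemma length_concat_map_ge:
  assumes "\<And>c. f c \<noteq> []"
  shows "length u \<le> length (concat (map f u))"
proof (induction u)
  case (Cons c u)
  have "0 < length (f c)"
    using assms by simp
  with Cons show ?case
    by (simp del: length_greater_0_conv)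
qed simp

lemma concat_map_concat_map:
  "concat (map g (concat (map f u))) = concat (map (\<lambda>c. concat (map g (f c))) u)"
  by (induction u) simp_all

lemma flat_smap_comp:
  assumes f: "\<And>c. f c \<noteq> []" and g: "\<And>c. g c \<noteq> []"
  shows "flat (smap g (flat (smap f s))) = flat (smap (\<lambda>c. concat (map g (f c))) s)"
proof (rule stream_eq_if_prefixes_eq)
  fix n
  let ?h = "\<lambda>c. concat (map g (f c))"
  \<comment> \<open>Images of letters are nonempty, so \<open>Suc n\<close> letters of
    \<open>s\<close> yield a common prefix longer than \<open>n\<close>.\<close>
  let ?p = "concat (map ?h (stake (Suc n) s))"
  have h: "?h c \<noteq> []" for c
    using f[of c] g by (cases "f c") auto
  have "n < length ?p"
    using length_concat_map_ge[of ?h "stake (Suc n) s", OF h] by (simp del: stake.simps)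
  moreover have "flat (smap g (flat (smap f s))) =
      ?p @- flat (smap g (flat (smap f (sdrop (Suc n) s))))"
    by (subst flat_smap_split[of f s "Suc n", OF f], subst flat_smap_shift[of g, OF g],
        subst concat_map_concat_map) simp
  moreover have "flat (smap ?h s) = ?p @- flat (smap ?h (sdrop (Suc n) s))"
    using h by (rule flat_smap_split)
  ultimately show "\<exists>p r r'. n < length p \<and> flat (smap g (flat (smap f s))) = p @- r \<and>
      flat (smap ?h s) = p @- r'"
    by blast
qed

text \<open>The letter \<open>d\<close> slides from right to left through the images one at a time,
  giving f(u)d = dg(u) for every finite word u.\<close>

lemma flat_smap_conjugate:
  assumes f: "\<And>c. f c \<noteq> []" and g: "\<And>c. g c \<noteq> []" and conj: "\<And>c. f c @ [d] = d # g c"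
  shows "flat (smap f s) = d ## flat (smap g s)"
proof (rule stream_eq_if_prefixes_eq)
  fix n
  have eq: "concat (map f u) @ [d] = d # concat (map g u)" for u
  proof (induction u)
    case (Cons c u)
    have "concat (map f (c # u)) @ [d] = f c @ d # concat (map g u)"
      using Cons by simp
    also have "\<dots> = (f c @ [d]) @ concat (map g u)"
      by simp
    finally show ?case
      by (simp add: conj)
  qed simp
  let ?p = "concat (map f (stake (Suc n) s))"
  have len: "n < length ?p"
    using length_concat_map_ge[of f "stake (Suc n) s", OF f] by (simp del: stake.simps)
  have "d # concat (map g (stake (Suc n) s)) = ?p @ [d]"
    by (simp only: eq)
  then have "d ## flat (smap g s) = ?p @- d ## flat (smap g (sdrop (Suc n) s))"
    by (subst flat_smap_split[of g s "Suc n", OF g])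
      (metis shift.simps shift_append)
  then show "\<exists>p r r'. n < length p \<and> flat (smap f s) = p @- r \<and> d ## flat (smap g s) = p @- r'"
    using len flat_smap_split[of f s "Suc n", OF f] by blast
qed

lemma flat_smap_singleton: "flat (smap (\<lambda>c. [g c]) s) = smap g s"
proof (rule stream_eq_if_prefixes_eq)
  fix n
  have "concat (map (\<lambda>c. [g c]) u) = map g u" for u
    by (induction u) simp_all
  then have "flat (smap (\<lambda>c. [g c]) s) =
      map g (stake (Suc n) s) @- flat (smap (\<lambda>c. [g c]) (sdrop (Suc n) s))"
    using flat_smap_split[of "\<lambda>c. [g c]" s "Suc n"] by (simp del: stake.simps)
  moreover have "smap g s = map g (stake (Suc n) s) @- smap g (sdrop (Suc n) s)"
    by (metis smap_shift stake_sdrop)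
  moreover have "n < length (map g (stake (Suc n) s))"
    by (simp del: stake.simps)
  ultimately show "\<exists>p r r'. n < length p \<and> flat (smap (\<lambda>c. [g c]) s) = p @- r \<and>
      smap g s = p @- r'"
    by blast
qed

lemma factor_flat_smap:
  assumes f: "\<And>c. f c \<noteq> []" and "factor u s"
  shows "factor (concat (map f u)) (flat (smap f s))"
proof -
  obtain p r where s: "s = p @- u @- r"
    using assms(2) by (auto simp: factor_iff)
  have "flat (smap f s) = concat (map f p) @- concat (map f u) @- flat (smap f r)"
    unfolding s using flat_smap_shift[of f, OF f] by metis
  then show ?thesis
    unfolding factor_iff by blast
qed

section \<open>Overlap-free words\<close>

text \<open>An overlap cxcxc, with c a letter, is written as vv followed by the first letter of v =
  cx.\<close>

definition overlap_free :: "'a stream \<Rightarrow> bool" where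
  "overlap_free s \<longleftrightarrow> (\<forall>v. v \<noteq> [] \<longrightarrow> \<not> factor (v @ v @ [hd v]) s)"

lemma overlap_free_sdrop: "overlap_free s \<Longrightarrow> overlap_free (sdrop k s)"
  unfolding overlap_free_def by (blast intro: factor_sdrop)

text \<open>The image of an overlap in \<open>s\<close> begins with an overlap: after the square xx
  comes \<open>f (hd v)\<close>, which starts with the first letter of x.\<close>

lemma overlap_free_flat_smapD:
  assumes f: "\<And>c. f c \<noteq> []" and free: "overlap_free (flat (smap f s))"
  shows "overlap_free s"
  unfolding overlap_free_def
proof (intro allI impI notI)
  fix v :: "'a list"
  assume v: "v \<noteq> []" and "factor (v @ v @ [hd v]) s"
  then have "factor (concat (map f (v @ v @ [hd v]))) (flat (smap f s))"
    using f by (intro factor_flat_smap)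
  moreover define x where "x = concat (map f v)"
  moreover have x: "x \<noteq> []" "f (hd v) = hd x # tl (f (hd v))"
    using v f by (auto simp: x_def neq_Nil_conv[of v])
  ultimately have "factor (x @ x @ [hd x] @ tl (f (hd v))) (flat (smap f s))"
    by simp
  then have "factor ([] @ (x @ x @ [hd x]) @ tl (f (hd v))) (flat (smap f s))"
    by simp
  then show False
    using free x(1) factor_infix unfolding overlap_free_def by blast
qed

text \<open>No overlap starts at the first letter of \<open>v @ d\<close> and has period greater than \<open>length v\<close>.\<close>

fun no_overlap_after :: "'a list \<Rightarrow> 'a list \<Rightarrow> bool" where
  "no_overlap_after v [] \<longleftrightarrow> True"
| "no_overlap_after v (x # d) \<longleftrightarrow>
     \<not> prefix (v @ [x, hd (v @ [x])]) d \<and> no_overlap_after (v @ [x]) d"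

lemma overlap_free_imp_no_overlap_after:
  assumes free: "overlap_free s" and "factor (v @ d) s"
  shows "no_overlap_after v d"
  using assms(2)
proof (induction d arbitrary: v)
  case (Cons x d)
  let ?v = "v @ [x]"
  have "\<not> prefix (?v @ [hd ?v]) d"
  proof
    assume "prefix (?v @ [hd ?v]) d"
    then obtain r where "d = (?v @ [hd ?v]) @ r"
      by (auto simp: prefix_def)
    then have "factor ([] @ (?v @ ?v @ [hd ?v]) @ r) s"
      using Cons.prems by simp
    with free show False
      unfolding overlap_free_def by (metis factor_infix snoc_eq_iff_butlast)
  qed
  with Cons show ?case
    by simp
qed simp

text \<open>Kept separate from the search because the evaluation of \<open>search_avoiding\<close> by rewriting would
  otherwise duplicate the recursive call.\<close>

definition left_extensions :: "letter list \<Rightarrow> letter list list \<Rightarrow> letter list list" where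
  "left_extensions z us =
     filter (\<lambda>u. no_overlap_after [] u \<and> \<not> prefix z u) (map ((#) A) us @ map ((#) B) us)"

fun search_avoiding :: "letter list \<Rightarrow> nat \<Rightarrow> letter list list" where
  "search_avoiding z 0 = [[]]"
| "search_avoiding z (Suc n) = left_extensions z (search_avoiding z n)"

text \<open>The search grows words at the left, so only overlaps and occurrences of \<open>z\<close>
  that start at the new first letter have to be tested.\<close>

lemma stake_in_search_avoiding:
  assumes free: "overlap_free s" and z: "\<not> factor z s"
  shows "stake n (sdrop i s) \<in> set (search_avoiding z n)"
proof (induction n arbitrary: i)
  case (Suc n)
  let ?u = "stake (Suc n) (sdrop i s)"
  have "factor ?u s"
    unfolding factor_def by (intro exI[of _ i]) (simp del: stake.simps)
  then have "no_overlap_after [] ?u"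
    using overlap_free_imp_no_overlap_after[OF free, of "[]"] by (metis append_Nil)
  moreover have "\<not> prefix z ?u"
    using z \<open>factor ?u s\<close> factor_infix[of "[]" z] by (auto simp: prefix_def)
  moreover have "?u = s !! i # stake n (sdrop (Suc i) s)"
    by (simp add: sdrop_simps)
  ultimately show ?case
    using Suc[of "Suc i"] by (cases "s !! i") (simp_all add: left_extensions_def del: sdrop.simps stake.simps no_overlap_after.simps)
qed simp

lemma overlap_free_factor_if_search_empty:
  assumes "overlap_free s" "search_avoiding z n = []"
  shows "factor z s"
  using stake_in_search_avoiding[of s z n 0] assms by auto

section \<open>Factors present in every overlap-free infinite word\<close>

lemma search_avoiding_AA: "search_avoiding [A, A] 9 = []"
  by code_simp

lemma search_avoiding_BB: "search_avoiding [B, B] 9 = []"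
  by code_simp

lemma search_avoiding_ABAB: "search_avoiding [A, B, A, B] 21 = []"
  by code_simp

lemma search_avoiding_BABA: "search_avoiding [B, A, B, A] 21 = []"
  by code_simp

lemmas overlap_free_factors =
  overlap_free_factor_if_search_empty[OF _ search_avoiding_AA]
  overlap_free_factor_if_search_empty[OF _ search_avoiding_BB]
  overlap_free_factor_if_search_empty[OF _ search_avoiding_ABAB]
  overlap_free_factor_if_search_empty[OF _ search_avoiding_BABA]

section \<open>The Prouhet-Thue-Morse word\<close>

lemma mu_letter_not_Nil: "mu_letter c \<noteq> []"
  by (cases c) simp_all

lemma act_mu: "act mu s = flat (smap mu_letter s)"
  by (simp add: act_def mu_def)

lemma act_mu_shift: "act mu (u @- s) = mu u @- act mu s"
  unfolding act_mu mu_def by (rule flat_smap_shift) (rule mu_letter_not_Nil)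

lemma sdrop_act_mu: "sdrop (2 * n) (act mu s) = act mu (sdrop n s)"
proof -
  have "act mu s = mu (stake n s) @- act mu (sdrop n s)"
    by (metis act_mu_shift stake_sdrop)
  then show ?thesis
    by (simp add: sdrop_shift length_mu)
qed

lemma stake_act_mu: "stake (2 * n) (act mu s) = mu (stake n s)"
proof -
  have "act mu s = mu (stake n s) @- act mu (sdrop n s)"
    by (metis act_mu_shift stake_sdrop)
  then show ?thesis
    by (simp add: stake_shift length_mu)
qed

lemma act_mu_snth_even: "act mu s !! (2 * n) = s !! n"
proof -
  have "act mu s !! (2 * n) = shd (act mu (sdrop n s))"
    by (metis sdrop_act_mu sdrop_simps(1))
  also have "\<dots> = s !! n"
    by (cases "s !! n") (simp_all add: act_mu sdrop_simps)
  finally show ?thesis .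
qed

lemma act_mu_snth_odd: "act mu s !! Suc (2 * n) \<noteq> s !! n"
proof -
  have "act mu s !! Suc (2 * n) = shd (stl (act mu (sdrop n s)))"
    by (metis sdrop_act_mu sdrop_simps sdrop.simps(2) sdrop_stl)
  also have "\<dots> \<noteq> s !! n"
    by (cases "s !! n") (simp_all add: act_mu sdrop_simps)
  finally show ?thesis .
qed

lemma act_mu_inject: "act mu s = act mu s' \<Longrightarrow> s = s'"
proof -
  assume "act mu s = act mu s'"
  then have "s !! n = s' !! n" for n
    by (metis act_mu_snth_even)
  then show ?thesis
    using smap_alt[of id s s'] by (simp add: stream.map_id)
qed

text \<open>\<mu>(t) has the prefixes that determine t uniquely. The prefix of length 1 is treated
  apart, since it is not a union of \<mu>-blocks.\<close>

lemma act_mu_thue_morse: "act mu thue_morse = thue_morse"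
proof -
  have "stake (2 ^ n) (act mu thue_morse) = (mu ^^ n) [A]" for n
  proof (cases n)
    case 0
    have "shd thue_morse = A"
      using stake_thue_morse[of 0] by simp
    then show ?thesis
      using act_mu_snth_even[of thue_morse 0] 0 by simp
  next
    case (Suc m)
    then show ?thesis
      by (simp add: stake_act_mu stake_thue_morse)
  qed
  then show ?thesis
    using thue_morse_ex1 stake_thue_morse by blast
qed

section \<open>Squares and overlaps in the Prouhet-Thue-Morse word\<close>

abbreviation tm :: "nat \<Rightarrow> letter" where
  "tm n \<equiv> thue_morse !! n"

lemma tm_even: "tm (2 * n) = tm n"
  using act_mu_snth_even[of thue_morse n] by (simp add: act_mu_thue_morse)

lemma tm_odd: "tm (Suc (2 * n)) \<noteq> tm n"
  using act_mu_snth_odd[of thue_morse n] by (simp add: act_mu_thue_morse)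

lemma letter_neq_neq: "(x :: letter) \<noteq> z \<Longrightarrow> y \<noteq> z \<Longrightarrow> x = y"
  by (cases x; cases y; cases z) simp_all

lemma tm_odd_eq_iff: "tm (Suc (2 * m)) = tm (Suc (2 * n)) \<longleftrightarrow> tm m = tm n"
  using tm_odd[of m] tm_odd[of n] letter_neq_neq by metis

text \<open>Counting from 0, each even position opens a block ab or ba, so equal neighbours lie in
  different blocks.\<close>

lemma tm_eq_Suc_imp_odd: "tm n = tm (Suc n) \<Longrightarrow> odd n"
  using tm_even tm_odd by (metis evenE)

lemma tm_no_cube: "\<not> (tm n = tm (Suc n) \<and> tm (Suc n) = tm (Suc (Suc n)))"
  using tm_eq_Suc_imp_odd[of n] tm_eq_Suc_imp_odd[of "Suc n"] by auto

text \<open>The three positions have the same parity, and along one parity class t is itself or its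
  complement; the claim descends to the absence of cubes of letters.\<close>

lemma tm_no_alternation: "\<not> (tm n = tm (n + 2) \<and> tm (n + 2) = tm (n + 4))"
proof (cases "even n")
  case True
  then obtain m where "n = 2 * m" by blast
  then have "n + 2 = 2 * Suc m" "n + 4 = 2 * Suc (Suc m)" by simp_all
  then show ?thesis
    using tm_no_cube[of m] \<open>n = 2 * m\<close> by (simp only: tm_even) simp
next
  case False
  then obtain m where "n = Suc (2 * m)" by (auto elim: oddE)
  then have "n + 2 = Suc (2 * Suc m)" "n + 4 = Suc (2 * Suc (Suc m))" by simp_all
  then show ?thesis
    using tm_no_cube[of m] \<open>n = Suc (2 * m)\<close> by (simp only: tm_odd_eq_iff) simp
qed

text \<open>Equal neighbours sit at odd positions only, so a repetition with odd period \<open>p\<close> alternates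
  between its two letters over a full period; this bounds the period.\<close>

lemma tm_odd_period_alternates:
  assumes "odd p" and "tm n = tm (n + p)" and "tm (Suc n) = tm (Suc n + p)"
  shows "tm n \<noteq> tm (Suc n)"
proof
  assume eq: "tm n = tm (Suc n)"
  then have "odd n"
    by (rule tm_eq_Suc_imp_odd)
  moreover have "tm (n + p) = tm (Suc (n + p))"
    using assms(2,3) eq by simp
  then have "odd (n + p)"
    by (rule tm_eq_Suc_imp_odd)
  ultimately show False
    using assms(1) by simp
qed

lemma tm_odd_square_period:
  assumes "odd p" and "\<And>j. j < p \<Longrightarrow> tm (i + j) = tm (i + j + p)"
  shows "p = 1 \<or> p = 3"
proof (rule ccontr)
  assume "\<not> (p = 1 \<or> p = 3)"
  with assms(1) have "4 < p"
    by presburger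
  \<comment> \<open>A period of at least 5 leaves room for five alternating letters, which
    \<open>tm_no_alternation\<close> excludes.\<close>
  then have neq: "tm (i + j) \<noteq> tm (i + Suc j)" if "j < 4" for j
    using tm_odd_period_alternates[OF assms(1), of "i + j"] assms(2)[of j] assms(2)[of "Suc j"]
      that \<open>4 < p\<close> by simp
  have "tm i = tm (i + 2)"
    using letter_neq_neq[of "tm i" "tm (i + 1)" "tm (i + 2)"] neq[of 0] neq[of 1]
    by (simp add: numeral_eq_Suc)
  moreover have "tm (i + 2) = tm (i + 4)"
    using letter_neq_neq[of "tm (i + 2)" "tm (i + 3)" "tm (i + 4)"] neq[of 2] neq[of 3]
    by (simp add: numeral_eq_Suc)
  ultimately show False
    using tm_no_alternation by blast
qed

text \<open>Descent on the period: an overlap of period 2q, sampled at every second position, gives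
  one of period q. An odd period can only be 1 or 3.\<close>

lemma tm_no_overlap:
  assumes "0 < p"
  shows "\<exists>j\<le>p. tm (i + j) \<noteq> tm (i + j + p)"
  using assms
proof (induction p arbitrary: i rule: less_induct)
  case (less p)
  show ?case
  proof (rule ccontr)
    assume "\<not> ?thesis"
    then have eq: "tm (i + j) = tm (i + j + p)" if "j \<le> p" for j
      using that by blast
    show False
    proof (cases "even p")
      case True
      then obtain q where q: "p = 2 * q" by blast
      then obtain j where j: "j \<le> q" "tm (i div 2 + j) \<noteq> tm (i div 2 + j + q)"
        using less.IH[of q "i div 2"] less.prems by auto
      show False
      proof (cases "even i")
        case True
        then have "i + 2 * j = 2 * (i div 2 + j)" "i + 2 * j + p = 2 * (i div 2 + j + q)"
          using q by auto
        then show False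
          using eq[of "2 * j"] j q by (metis tm_even mult_le_mono2)
      next
        case False
        then have "i + 2 * j = Suc (2 * (i div 2 + j))"
          "i + 2 * j + p = Suc (2 * (i div 2 + j + q))"
          using q by presburger+
        then show False
          using eq[of "2 * j"] j q by (metis tm_odd_eq_iff mult_le_mono2)
      qed
    next
      case False
      then have "p = 1 \<or> p = 3"
        using tm_odd_square_period eq by (meson less_imp_le)
      then show False
      proof
        assume "p = 1"
        then show False
          using eq[of 0] eq[of 1] tm_no_cube[of i] by simp
      next
        assume p: "p = 3"
        \<comment> \<open>The case j = 2 uses the extra letter of the overlap. Three alternations
          give distinct letters at distance 3, against the period; the squares of aba and bab alone
          would not.\<close>
        have "tm (i + j) \<noteq> tm (i + Suc j)" if "j < 3" for j
          using tm_odd_period_alternates[of p "i + j"] eq[of j] eq[of "Suc j"] that p by simp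
        from this[of 0] this[of 1] this[of 2] eq[of 0] p show False
          using letter_neq_neq[of "tm i" "tm (i + 1)" "tm (i + 2)"]
          by (simp add: numeral_eq_Suc)
      qed
    qed
  qed
qed

lemma factor_nth:
  assumes "factor u s"
  obtains i where "\<And>j. j < length u \<Longrightarrow> s !! (i + j) = u ! j"
  using assms unfolding factor_def by (metis stake_nth sdrop_snth)

lemma overlap_free_thue_morse: "overlap_free thue_morse"
  unfolding overlap_free_def
proof (intro allI impI notI)
  fix v :: "letter list"
  assume v: "v \<noteq> []" and "factor (v @ v @ [hd v]) thue_morse"
  then obtain i where i: "\<And>j. j < length (v @ v @ [hd v]) \<Longrightarrow> tm (i + j) = (v @ v @ [hd v]) ! j"
    using factor_nth by blast
  let ?p = "length v"
  have "tm (i + j) = tm (i + j + ?p)" if "j \<le> ?p" for j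
  proof (cases "j = ?p")
    case True
    then show ?thesis
      using i[of j] i[of "j + ?p"] v by (simp add: nth_append hd_conv_nth add.assoc)
  next
    case False
    then show ?thesis
      using i[of j] i[of "j + ?p"] that v by (simp add: nth_append add.assoc)
  qed
  then show False
    using tm_no_overlap[of ?p i] v by auto
qed

lemma thue_morse_odd_square:
  assumes "factor (v @ v) thue_morse" and "odd (length v)"
  shows "v \<in> {[A], [B], [A, B, A], [B, A, B]}"
proof -
  obtain i where i: "\<And>j. j < length (v @ v) \<Longrightarrow> tm (i + j) = (v @ v) ! j"
    using assms(1) factor_nth by blast
  have square: "tm (i + j) = tm (i + j + length v)" if "j < length v" for j
    using i[of j] i[of "j + length v"] that by (simp add: nth_append add.assoc)
  have "length v = 1 \<or> length v = 3"
    using tm_odd_square_period[OF assms(2) square] .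
  then show ?thesis
  proof
    assume "length v = 1"
    then obtain x where "v = [x]"
      by (auto simp: length_Suc_conv)
    then show ?thesis
      by (cases x) simp_all
  next
    assume len: "length v = 3"
    then obtain x y z where v: "v = [x, y, z]"
      by (auto simp: length_Suc_conv numeral_eq_Suc)
    have "v ! j \<noteq> v ! Suc j" if "Suc j < length v" for j
      using tm_odd_period_alternates[OF assms(2), of "i + j"] square[of j] square[of "Suc j"]
        i[of j] i[of "Suc j"] that
      by (simp add: nth_append)
    from this[of 0] this[of 1] have "x \<noteq> y" "y \<noteq> z"
      by (simp_all add: v)
    then show ?thesis
      by (cases x; cases y; cases z) (simp_all add: v)
  qed
qed

section \<open>Position of factors relative to the \<mu>-blocks\<close>

lemma thue_morse_aligned_block:
  assumes "even k" and "even (length u)" and "sdrop k thue_morse = u @- r"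
  shows "\<exists>u'. u = mu u'"
proof -
  obtain m l where "k = 2 * m" "length u = 2 * l"
    using assms(1,2) by blast
  moreover have "stake (2 * l) (sdrop (2 * m) thue_morse) = mu (stake l (sdrop m thue_morse))"
    by (metis act_mu_thue_morse sdrop_act_mu stake_act_mu)
  ultimately have "u = mu (stake l (sdrop m thue_morse))"
    using assms(3) by (simp add: stake_shift)
  then show ?thesis ..
qed

text \<open>The last letter of \<open>x\<close> falls on an even position, so it forms a \<mu>-block
  with the first letter of \<open>y\<close>.\<close>

lemma thue_morse_straddle:
  assumes "odd k" and "even (length x)" and "x \<noteq> []" and "y \<noteq> []"
    and "sdrop k thue_morse = x @- y @- r"
  shows "last x \<noteq> hd y"
proof -
  let ?n = "k + (length x - 1)"
  have "even ?n"
    using assms(1,2,3) by (cases x) auto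
  have "tm ?n = last x"
    using assms(3,5) by (simp add: sdrop_snth[symmetric] last_conv_nth)
  moreover have "tm (Suc ?n) = hd y"
  proof -
    have "Suc ?n = k + length x"
      using assms(3) by (cases x) simp_all
    then have "tm (Suc ?n) = (x @- y @- r) !! length x"
      using assms(5) by (metis sdrop_snth)
    then show ?thesis
      using assms(4) by (simp add: hd_conv_nth)
  qed
  ultimately show ?thesis
    using tm_eq_Suc_imp_odd[of ?n] \<open>even ?n\<close> by auto
qed

section \<open>Desubstitution\<close>

lemma even_length_concat_map: "(\<And>c. even (length (f c))) \<Longrightarrow> even (length (concat (map f u)))"
  by (induction u) simp_all

lemma odd_length_images:
  assumes f: "\<And>c :: letter. f c \<noteq> []" and eq: "flat (smap f w) = sdrop k thue_morse"
    and free: "overlap_free w" and odd: "odd (length (f A)) \<or> odd (length (f B))"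
  shows "f A = [A] \<and> f B = [B] \<or> f A = [B] \<and> f B = [A]"
proof -
  have img: "factor (concat (map f u)) thue_morse" if "factor u w" for u
    using factor_flat_smap[of f, OF f that] unfolding eq by (rule factor_sdrop)
  have sq: "factor (f A @ f A) thue_morse" "factor (f B @ f B) thue_morse"
    "factor ((f A @ f B) @ (f A @ f B)) thue_morse" "factor ((f B @ f A) @ (f B @ f A)) thue_morse"
    using overlap_free_factors[OF free, THEN img] by simp_all
  \<comment> \<open>The overlap test looks only at the start of a word; dropping \<open>n\<close>
    letters moves it. Offsets 0, 2 and 3 eliminate all unwanted pairs when both lengths are
    odd.\<close>
  have no_overlap: "no_overlap_after [] (drop n ((f A @ f B) @ (f A @ f B)))" for n
    using overlap_free_imp_no_overlap_after[OF overlap_free_thue_morse, of "[]"] sq(3)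
      factor_infix[of "take n ((f A @ f B) @ (f A @ f B))" _ "[]"]
    by (metis append_Nil append_Nil2 append_take_drop_id)
  consider "odd (length (f A))" "odd (length (f B))" |
      "odd (length (f A @ f B))" "odd (length (f B @ f A))"
    using odd by auto
  then show ?thesis
  proof cases
    case 1
    then have "f A \<in> {[A], [B], [A, B, A], [B, A, B]}" "f B \<in> {[A], [B], [A, B, A], [B, A, B]}"
      using thue_morse_odd_square sq(1,2) by blast+
    then show ?thesis
      using no_overlap[of 0] no_overlap[of 2] no_overlap[of 3] by auto
  next
    case 2
    then have "f A @ f B \<in> {[A], [B], [A, B, A], [B, A, B]}"
      "f B @ f A \<in> {[A], [B], [A, B, A], [B, A, B]}"
      using thue_morse_odd_square sq(3,4) by blast+
    then show ?thesis
      \<comment> \<open>Both images are nonempty, so the product is aba or bab; exchanging its two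
        parts creates equal neighbours, which no listed word has.\<close>
      using f[of A] f[of B] by (auto simp: append_eq_Cons_conv)
  qed
qed

text \<open>If the images start at odd positions, neighbouring images are separated by the two distinct
  letters of a \<open>\<mu>\<close>-block, so all images start with the same letter and a cyclic shift realigns
  them.\<close>

lemma align_images:
  assumes f: "\<And>c :: letter. f c \<noteq> []" and eq: "flat (smap f w) = sdrop k thue_morse"
    and free: "overlap_free w" and even: "\<And>c. even (length (f c))"
  obtains g l where "\<And>c. g c \<noteq> []" "\<And>c. length (g c) = length (f c)" "even l"
    "flat (smap g w) = sdrop l thue_morse"
proof (cases "even k")
  case True
  then show ?thesis
    using that f eq by blast
next
  case False
  have differ: "last (f c) \<noteq> hd (f d)" if "factor [c, d] w" for c d
  proof -
    obtain p r where w: "w = p @- [c, d] @- r"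
      using \<open>factor [c, d] w\<close> by (auto simp: factor_iff)
    have "sdrop k thue_morse = concat (map f p) @- f c @- f d @- flat (smap f r)"
      unfolding eq[symmetric] w by (subst flat_smap_shift[of f, OF f]) (simp add: f)
    then have "sdrop (k + length (concat (map f p))) thue_morse =
        f c @- f d @- flat (smap f r)"
      by (simp add: sdrop_add[symmetric] sdrop_shift del: sdrop_add)
    then show ?thesis
      using f even False even_length_concat_map[of f p] by (intro thue_morse_straddle) auto
  qed
  have "factor ([A] @ [A, B] @ []) w \<or> factor ([] @ [A, B] @ [A, B]) w"
    using overlap_free_factors(3)[OF free] by simp
  then have "factor [A, B] w"
    using factor_infix by blast
  \<comment> \<open>Since ab and aa occur in \<open>w\<close>, both first letters differ from the
    last letter of \<open>f A\<close>.\<close>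
  then have "hd (f B) = hd (f A)"
    using differ[of A B] differ[of A A] overlap_free_factors(1)[OF free] letter_neq_neq by metis
  then have hd: "hd (f c) = hd (f A)" for c
    by (cases c) simp_all
  define d where "d = hd (f A)"
  define g where "g c = tl (f c) @ [d]" for c
  have conj: "f c @ [d] = d # g c" for c
    using hd[of c] f[of c] by (cases "f c") (simp_all add: g_def d_def)
  have g: "g c \<noteq> []" "length (g c) = length (f c)" for c
    using f[of c] by (auto simp: g_def)
  have "flat (smap f w) = d ## flat (smap g w)"
    using f g(1) conj by (rule flat_smap_conjugate)
  then have "flat (smap g w) = sdrop (Suc k) thue_morse"
    using eq by (metis sdrop.simps(2) sdrop_stl stream.sel(2))
  then show ?thesis
    using that[of g "Suc k"] g False by simp
qed

text \<open>Both letters occur in \<open>w\<close>, so each image appears at an even position of t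
  and is a product of \<mu>-blocks. Injectivity of \<mu> on infinite words then cancels one
  \<mu>.\<close>

lemma desubstitute_images:
  assumes g: "\<And>c :: letter. g c \<noteq> []" and eq: "flat (smap g w) = sdrop l thue_morse"
    and free: "overlap_free w" and even: "\<And>c. even (length (g c))" "even l"
  obtains h m where "\<And>c. h c \<noteq> []" "\<And>c. length (g c) = 2 * length (h c)"
    "flat (smap h w) = sdrop m thue_morse"
proof -
  have "factor ([] @ [A] @ [A]) w" "factor ([] @ [B] @ [B]) w"
    using overlap_free_factors[OF free] by simp_all
  then have occurs: "factor [c] w" for c
    using factor_infix by (cases c) blast+
  have "\<exists>u. g c = mu u" for c
  proof -
    obtain p r where w: "w = p @- [c] @- r"
      using occurs[of c] by (auto simp: factor_iff)
    have "sdrop l thue_morse = concat (map g p) @- g c @- flat (smap g r)"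
      unfolding eq[symmetric] w by (subst flat_smap_shift[of g, OF g]) (simp add: g)
    then have "sdrop (l + length (concat (map g p))) thue_morse = g c @- flat (smap g r)"
      by (simp add: sdrop_add[symmetric] sdrop_shift del: sdrop_add)
    then show ?thesis
      using even even_length_concat_map[of g p] by (intro thue_morse_aligned_block) auto
  qed
  then obtain h where h: "\<And>c. g c = mu (h c)"
    by metis
  have h_ne: "h c \<noteq> []" for c
    using g[of c] by (auto simp: h mu_def)
  have len: "length (g c) = 2 * length (h c)" for c
    by (simp add: h length_mu)
  obtain m where m: "l = 2 * m"
    using even(2) by blast
  have "act mu (flat (smap h w)) = flat (smap g w)"
    using flat_smap_comp[of h mu_letter w, OF h_ne mu_letter_not_Nil]
    by (simp add: act_mu h[abs_def] mu_def)
  also have "\<dots> = act mu (sdrop m thue_morse)"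
    unfolding eq m by (metis act_mu_thue_morse sdrop_act_mu)
  finally have "flat (smap h w) = sdrop m thue_morse"
    by (rule act_mu_inject)
  then show ?thesis
    using that h_ne len by blast
qed

section \<open>The exchange of letters and the final descent\<close>

fun flip :: "letter \<Rightarrow> letter" where
  "flip A = B"
| "flip B = A"

lemma act_xi: "act xi s = smap flip s"
proof -
  have "xi [c] = [flip c]" for c
    by (cases c) (simp_all add: xi_def)
  then show ?thesis
    by (simp add: act_def flat_smap_singleton)
qed

lemma act_xi_act_xi: "act xi (act xi s) = s"
proof -
  have "flip \<circ> flip = id"
  proof
    fix c show "(flip \<circ> flip) c = id c" by (cases c) simp_all
  qed
  then show ?thesis
    by (simp add: act_xi stream.map_comp stream.map_id)
qed

text \<open>The induction varies \<open>k\<close> along with \<open>f\<close>, because realignment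
  and cancelling \<mu> both move the starting position in t.\<close>

lemma suffix_if_image_suffix_thue_morse:
  assumes "\<And>c. f c \<noteq> []" and "flat (smap f w) = sdrop k thue_morse"
  shows "is_suffix w thue_morse \<or> is_suffix w (act xi thue_morse)"
  using assms
proof (induction "length (f A) + length (f B)" arbitrary: f k rule: less_induct)
  case less
  note f = less.prems(1) and eq = less.prems(2)
  have "overlap_free (flat (smap f w))"
    unfolding eq by (intro overlap_free_sdrop overlap_free_thue_morse)
  then have free: "overlap_free w"
    using f overlap_free_flat_smapD by blast
  show ?case
  proof (cases "odd (length (f A)) \<or> odd (length (f B))")
    case True
    then consider "f A = [A]" "f B = [B]" | "f A = [B]" "f B = [A]"
      using odd_length_images[of f, OF f eq free] by blast
    then show ?thesis
    proof cases
      case 1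
      then have "f c = [id c]" for c
        by (cases c) simp_all
      then have "w = sdrop k thue_morse"
        using eq by (simp add: flat_smap_singleton stream.map_id[unfolded id_def] cong: stream.map_cong)
      then show ?thesis
        by (auto simp: is_suffix_def)
    next
      case 2
      then have "f c = [flip c]" for c
        by (cases c) simp_all
      then have "act xi w = sdrop k thue_morse"
        using eq by (simp add: act_xi flat_smap_singleton cong: stream.map_cong)
      then have "w = sdrop k (act xi thue_morse)"
        using act_xi_act_xi[of w] by (simp add: act_xi)
      then show ?thesis
        by (auto simp: is_suffix_def)
    qed
  next
    case False
    then have even: "even (length (f c))" for c
      by (cases c) simp_all
    obtain g l where g: "\<And>c. g c \<noteq> []" "\<And>c. length (g c) = length (f c)" "even l"
        "flat (smap g w) = sdrop l thue_morse"
      using align_images[of f w k] f eq free even by metis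
    obtain h m where h: "\<And>c. h c \<noteq> []" "\<And>c. length (g c) = 2 * length (h c)"
        "flat (smap h w) = sdrop m thue_morse"
      using desubstitute_images[of g w l] g free even by metis
    \<comment> \<open>Cancelling \<mu> halves every length; the decrease is strict because images
      are nonempty.\<close>
    have "length (h c) < length (f c)" for c
      using h(1)[of c] h(2)[of c] g(2)[of c] by (cases "h c") simp_all
    from this[of A] this[of B] show ?thesis
      using less.hyps[of h m] h by simp
  qed
qed

theorem corollary4p4:
  fixes w :: "letter stream"
  assumes "\<exists>phi. semigroup_endo phi \<and>
             (is_suffix (act phi w) thue_morse \<or> is_suffix (act phi w) (act xi thue_morse))"
  shows "is_suffix w thue_morse \<or> is_suffix w (act xi thue_morse)"
proof -
  obtain phi where "semigroup_endo phi" and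
    suffix: "is_suffix (act phi w) thue_morse \<or> is_suffix (act phi w) (act xi thue_morse)"
    using assms by blast
  then have phi: "phi [c] \<noteq> []" for c
    by (simp add: semigroup_endo_def)
  from suffix show ?thesis
  proof
    assume "is_suffix (act phi w) thue_morse"
    then show ?thesis
      using suffix_if_image_suffix_thue_morse[of "\<lambda>c. phi [c]" w] phi
      by (auto simp: is_suffix_def act_def)
  next
    assume "is_suffix (act phi w) (act xi thue_morse)"
    then obtain k where "act phi w = sdrop k (act xi thue_morse)"
      by (auto simp: is_suffix_def)
    then have "act xi (act phi w) = sdrop k (act xi (act xi thue_morse))"
      by (simp add: act_xi)
    then have "act xi (act phi w) = sdrop k thue_morse"
      by (simp only: act_xi_act_xi)
    moreover have xi_ne: "xi_letter c \<noteq> []" for c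
      by (cases c) simp_all
    moreover have "act xi (act phi w) = flat (smap (\<lambda>c. xi (phi [c])) w)"
      using flat_smap_comp[of "\<lambda>c. phi [c]" xi_letter w, OF phi xi_ne]
      by (simp add: act_def xi_def)
    moreover have "xi (phi [c]) \<noteq> []" for c
      using semigroup_endo_xi phi by (simp add: semigroup_endo_def)
    ultimately show ?thesis
      using suffix_if_image_suffix_thue_morse[of "\<lambda>c. xi (phi [c])" w k] by simp
  qed
qed

end
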